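(* Let $(X,\mu,\rho)$ be an admissible metric triple and let $\xi$ be a measurable partition of $X$, with quotient measure $\mu_\xi$ on the base $X/\xi$ and canonical system of conditional measures $\mu^C$, $C\in X/\xi$. Then: 1) The restriction $\rho^C=\rho|_{C\times C}$ of the metric $\rho$ to $\mu_\xi$-almost every element $C$ of $\xi$ is well defined and determines the structure of an admissible triple $(C,\mu^C,\rho^C)$; that is, for $\mu_\xi$-almost every $C$, $\rho^C$ is an admissible metric on the Lebesgue space $(C,\mu^C)$. 2) Let $n$ be a positive integer and let $\Omega$ be any open set in the $n^2$-dimensional space of real $n\times n$ matrices. For $\mu_\xi$-almost every $C$, let $p_\Omega(C)$ denote the probability that the matrix $(\rho^C(z_i,z_j))_{1\le i,j\le n}$ belongs to $\Omega$, where $z_1,\dots,z_n$ are independent points of $C$ distributed according to $\mu^C$. Then $p_\Omega$ is a measurable function of $C\in X/\xi$.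
   Context: $(X,\mu)$ is a Lebesgue space (standard probability space, $\mu(X)=1$). A metric $\rho$ on a Lebesgue space $(X,\mu)$ is admissible if it is measurable as a function on the Lebesgue space $(X\times X,\mu\times\mu)$ and there is a set $X_1\subset X$ of full measure such that $(X_1,\rho)$ is separable; admissible metrics are assumed summable: $\int_X\int_X\rho\,d\mu\,d\mu<\infty$. Then $(X,\mu,\rho)$ is called an admissible (metric) triple. Lebesgue spaces may have atoms. A measurable partition $\xi$ of $X$ is the partition into preimages of points under a measurable map from $(X,\mu)$ to another Lebesgue space. The base $X/\xi$ with the image $\mu_\xi$ of $\mu$ under the quotient map is a Lebesgue space. The canonical system of conditional measures (Rokhlin) is the (essentially unique) family of probability measures $\mu^C$ on $\mu_\xi$-almost all elements $C$ of $\xi$, such that $(C,\mu^C)$ is a Lebesgue space and, for every $f\in L^1(X,\mu)$, the restriction $f|_C$ is $\mu^C$-integrable for almost all $C$, $C\mapsto\int_C f\,d\mu^C$ is measurable, and $\int_X f\,d\mu=\int_{X/\xi}\int_C f\,d\mu^C\,d\mu_\xi(C)$. *)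

theory Defs
  imports "HOL-Probability.Probability"
begin

text \<open>
  The model space: Lebesgue measure on the interval from 0 to \<open>a\<close>, plus countably many atoms of
  mass \<open>w n\<close> at the negative integers, completed. Finitely many atoms, or none, are obtained by
  taking \<open>w n = 0\<close> for the unused indices.
\<close>

definition interval_with_atoms :: "real \<Rightarrow> (nat \<Rightarrow> ennreal) \<Rightarrow> real measure" where
  "interval_with_atoms a w =
     completion (measure_of UNIV (sets borel)
       (\<lambda>B. emeasure lborel (B \<inter> {0..a}) + (\<Sum>n. w n * indicator B (- real (Suc n)))))"

definition isomorphic_mod_0 :: "'a measure \<Rightarrow> 'b measure \<Rightarrow> bool" where
  "isomorphic_mod_0 M N \<longleftrightarrow>
     (\<exists>X\<^sub>0 \<in> sets M. \<exists>Y\<^sub>0 \<in> sets N. \<exists>f.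
        space M - X\<^sub>0 \<in> null_sets M \<and> space N - Y\<^sub>0 \<in> null_sets N \<and>
        bij_betw f X\<^sub>0 Y\<^sub>0 \<and>
        f \<in> restrict_space M X\<^sub>0 \<rightarrow>\<^sub>M restrict_space N Y\<^sub>0 \<and>
        the_inv_into X\<^sub>0 f \<in> restrict_space N Y\<^sub>0 \<rightarrow>\<^sub>M restrict_space M X\<^sub>0 \<and>
        distr (restrict_space M X\<^sub>0) (restrict_space N Y\<^sub>0) f = restrict_space N Y\<^sub>0)"

text \<open>The \<open>\<sigma>\<close>-algebra of a Lebesgue space is complete, in the tradition of Rokhlin.\<close>

definition lebesgue_space :: "'a measure \<Rightarrow> bool" where
  "lebesgue_space M \<longleftrightarrow>
     prob_space M \<and> complete_measure M \<and>
     (\<exists>a w. prob_space (interval_with_atoms a w) \<and> isomorphic_mod_0 M (interval_with_atoms a w))"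

text \<open>
  The \<open>\<sigma>\<close>-algebra of the Lebesgue space \<open>X \<times> X\<close> is the completion of the product \<open>\<sigma>\<close>-algebra.
  All conditions concern \<open>\<rho>\<close> on \<open>space M\<close> only, except that the library's
  \<open>Metric_space\<close> asks for nonnegativity and symmetry also at irrelevant arguments; so
  a measure with a smaller underlying set \<open>C\<close> makes this a statement about the restriction
  of \<open>\<rho>\<close> to \<open>C \<times> C\<close>.
\<close>

definition admissible_metric :: "'a measure \<Rightarrow> ('a \<Rightarrow> 'a \<Rightarrow> real) \<Rightarrow> bool" where
  "admissible_metric M \<rho> \<longleftrightarrow>
     Metric_space (space M) \<rho> \<and>
     (\<lambda>(x, y). \<rho> x y) \<in> borel_measurable (completion (M \<Otimes>\<^sub>M M)) \<and>
     (\<exists>X\<^sub>1 \<in> sets M. space M - X\<^sub>1 \<in> null_sets M \<and>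
        separable_space (Metric_space.mtopology X\<^sub>1 \<rho>)) \<and>
     (\<integral>\<^sup>+ x. \<integral>\<^sup>+ y. ennreal (\<rho> x y) \<partial>M \<partial>M) < \<infinity>"

definition admissible_triple :: "'a measure \<Rightarrow> ('a \<Rightarrow> 'a \<Rightarrow> real) \<Rightarrow> bool" where
  "admissible_triple M \<rho> \<longleftrightarrow> lebesgue_space M \<and> admissible_metric M \<rho>"

definition measurable_partition ::
  "'a measure \<Rightarrow> 'b measure \<Rightarrow> ('a \<Rightarrow> 'b) \<Rightarrow> 'a set set \<Rightarrow> bool" where
  "measurable_partition M N \<pi> \<xi> \<longleftrightarrow>
     lebesgue_space N \<and> \<pi> \<in> M \<rightarrow>\<^sub>M N \<and>
     \<xi> = (\<lambda>y. \<pi> -` {y} \<inter> space M) ` (\<pi> ` space M)"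

text \<open>
  The base \<open>X/\<xi>\<close>: its points are the elements of \<open>\<xi>\<close>. The preimage of a set \<open>\<A>\<close> of
  elements under the quotient map is \<open>\<Union>\<A>\<close>, so \<open>\<A>\<close> is measurable iff \<open>\<Union>\<A>\<close> is,
  and the image measure of \<open>\<A>\<close> is the measure of \<open>\<Union>\<A>\<close>.
\<close>

definition quotient_measure :: "'a measure \<Rightarrow> 'a set set \<Rightarrow> 'a set measure" where
  "quotient_measure M \<xi> =
     measure_of \<xi> {\<A>. \<A> \<subseteq> \<xi> \<and> \<Union>\<A> \<in> sets M} (\<lambda>\<A>. emeasure M (\<Union>\<A>))"

text \<open>
  For an integrable \<open>f\<close>, the function \<open>C \<mapsto> \<integral>f d\<mu>\<^sup>C\<close> is defined almost everywhere only; Bochner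
  integrals of non-integrable functions are 0, which is harmless as the base is complete.
\<close>

definition canonical_system ::
  "'a measure \<Rightarrow> 'a set set \<Rightarrow> ('a set \<Rightarrow> 'a measure) \<Rightarrow> bool" where
  "canonical_system M \<xi> \<mu> \<longleftrightarrow>
     (AE C in quotient_measure M \<xi>. lebesgue_space (\<mu> C) \<and> space (\<mu> C) = C) \<and>
     (\<forall>f :: 'a \<Rightarrow> real. integrable M f \<longrightarrow>
        (AE C in quotient_measure M \<xi>. integrable (\<mu> C) f) \<and>
        integrable (quotient_measure M \<xi>) (\<lambda>C. \<integral>x. f x \<partial>\<mu> C) \<and>
        (\<integral>x. f x \<partial>M) = (\<integral>C. (\<integral>x. f x \<partial>\<mu> C) \<partial>quotient_measure M \<xi>))"

text \<open>
  Matrices are indexed by a finite type \<open>'n\<close>. The joint law of \<open>n\<close> independent points is the product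
  measure, completed since an admissible metric is measurable only up to null sets.
\<close>

definition distance_matrix_event ::
  "'a measure \<Rightarrow> ('a \<Rightarrow> 'a \<Rightarrow> real) \<Rightarrow> (real^'n^'n) set \<Rightarrow> ('n \<Rightarrow> 'a) set" where
  "distance_matrix_event M \<rho> \<Omega> =
     {z \<in> space (Pi\<^sub>M UNIV (\<lambda>_. M)). (\<chi> i j. \<rho> (z i) (z j)) \<in> \<Omega>}"

definition distance_matrix_prob ::
  "'a measure \<Rightarrow> ('a \<Rightarrow> 'a \<Rightarrow> real) \<Rightarrow> (real^'n^'n) set \<Rightarrow> real" where
  "distance_matrix_prob M \<rho> \<Omega> =
     measure (completion (Pi\<^sub>M UNIV (\<lambda>_. M))) (distance_matrix_event M \<rho> \<Omega>)"

lemma emeasure_interval_with_atoms: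
  assumes "B \<in> sets borel"
  shows "emeasure (interval_with_atoms a w) B =
           emeasure lborel (B \<inter> {0..a}) + (\<Sum>n. w n * indicator B (- real (Suc n)))"
proof -
  let ?\<nu> = "\<lambda>B. emeasure lborel (B \<inter> {0..a}) + (\<Sum>n. w n * indicator B (- real (Suc n)))"
  let ?N = "measure_of UNIV (sets borel) ?\<nu>"
  have ca: "countably_additive (sets borel) ?\<nu>"
  proof (rule countably_additiveI)
    fix A :: "nat \<Rightarrow> real set"
    assume A: "range A \<subseteq> sets borel" "disjoint_family A"
    have "(\<Sum>i. ?\<nu> (A i)) = (\<Sum>i. emeasure lborel (A i \<inter> {0..a})) +
            (\<Sum>i. \<Sum>n. w n * indicator (A i) (- real (Suc n)))"
      by (rule suminf_add[symmetric]) auto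
    also have "(\<Sum>i. emeasure lborel (A i \<inter> {0..a})) = emeasure lborel (\<Union>i. A i \<inter> {0..a})"
      using A by (intro suminf_emeasure) (auto simp: disjoint_family_on_def)
    also have "(\<Union>i. A i \<inter> {0..a}) = (\<Union>i. A i) \<inter> {0..a}" by auto
    also have "(\<Sum>i. \<Sum>n. w n * indicator (A i) (- real (Suc n)))
        = (\<integral>\<^sup>+ i. (\<integral>\<^sup>+ n. w n * indicator (A i) (- real (Suc n)) \<partial>count_space UNIV) \<partial>count_space UNIV)"
      by (simp add: nn_integral_count_space_nat)
    also have "\<dots> = (\<integral>\<^sup>+ n. (\<integral>\<^sup>+ i. w n * indicator (A i) (- real (Suc n)) \<partial>count_space UNIV) \<partial>count_space UNIV)"
      using nn_integral_fst_count_space[of "\<lambda>(i, n). w n * indicator (A i) (- real (Suc n))"]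
        nn_integral_snd_count_space[of "\<lambda>(i, n). w n * indicator (A i) (- real (Suc n))"]
      by simp
    also have "\<dots> = (\<Sum>n. w n * indicator (\<Union>i. A i) (- real (Suc n)))"
      using suminf_indicator[OF A(2)] by (simp add: nn_integral_count_space_nat)
    finally show "(\<Sum>i. ?\<nu> (A i)) = ?\<nu> (\<Union>i. A i)" .
  qed
  have sa: "sigma_algebra (UNIV :: real set) (sets borel)"
    using sets.sigma_algebra_axioms[of "borel :: real measure"] by simp
  have "sets ?N = sets borel"
    using sa by (simp add: sigma_algebra.sigma_sets_eq)
  moreover have "emeasure ?N B = ?\<nu> B"
    using assms ca by (intro emeasure_measure_of_sigma sa) (auto simp: positive_def)
  ultimately show ?thesis
    using assms by (simp add: interval_with_atoms_def)
qed

lemma partition_on_measurable_partition: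
  assumes "measurable_partition M N \<pi> \<xi>"
  shows "partition_on (space M) \<xi>"
  using assms unfolding measurable_partition_def partition_on_def disjoint_def by auto

lemma quotient_measure:
  assumes "partition_on (space M) \<xi>"
  shows space_quotient_measure: "space (quotient_measure M \<xi>) = \<xi>"
    and sets_quotient_measure: "sets (quotient_measure M \<xi>) = {\<A>. \<A> \<subseteq> \<xi> \<and> \<Union>\<A> \<in> sets M}"
    and emeasure_quotient_measure:
      "\<A> \<in> sets (quotient_measure M \<xi>) \<Longrightarrow> emeasure (quotient_measure M \<xi>) \<A> = emeasure M (\<Union>\<A>)"
proof -
  let ?S = "{\<A>. \<A> \<subseteq> \<xi> \<and> \<Union>\<A> \<in> sets M}"
  have U: "\<Union>\<xi> = space M" and d: "disjoint \<xi>"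
    using assms by (auto simp: partition_on_def)
  have dis: "C = D" if "C \<in> \<xi>" "D \<in> \<xi>" "x \<in> C" "x \<in> D" for C D x
    using d that by (auto simp: disjoint_def)
  have diff: "\<Union>(\<xi> - \<A>) = space M - \<Union>\<A>" if "\<A> \<subseteq> \<xi>" for \<A>
    using that U dis by blast
  have sa: "sigma_algebra \<xi> ?S"
  proof (rule sigma_algebra_iff2[THEN iffD2], safe)
    fix \<A> assume "\<A> \<subseteq> \<xi>" "\<Union>\<A> \<in> sets M"
    then show "\<Union>(\<xi> - \<A>) \<in> sets M" by (simp add: diff sets.compl_sets)
  next
    fix \<A> :: "nat \<Rightarrow> 'a set set" assume "range \<A> \<subseteq> ?S"
    then have "(\<Union>i. \<Union>(\<A> i)) \<in> sets M" by (intro sets.countable_UN) auto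
    also have "(\<Union>i. \<Union>(\<A> i)) = \<Union>(\<Union>(range \<A>))" by blast
    finally show "\<Union>(\<Union>(range \<A>)) \<in> sets M" .
  qed (auto simp: subset_iff)
  show "space (quotient_measure M \<xi>) = \<xi>"
    unfolding quotient_measure_def by (rule space_measure_of) auto
  show s: "sets (quotient_measure M \<xi>) = ?S"
    unfolding quotient_measure_def using sa by (simp add: sigma_algebra.sets_measure_of_eq)
  have ca: "countably_additive ?S (\<lambda>\<A>. emeasure M (\<Union>\<A>))"
  proof (rule countably_additiveI)
    fix \<A> :: "nat \<Rightarrow> 'a set set"
    assume A: "range \<A> \<subseteq> ?S" "disjoint_family \<A>"
    have "(\<Sum>i. emeasure M (\<Union>(\<A> i))) = emeasure M (\<Union>i. \<Union>(\<A> i))"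
    proof (rule suminf_emeasure)
      show "range (\<lambda>i. \<Union>(\<A> i)) \<subseteq> sets M" using A(1) by auto
      show "disjoint_family (\<lambda>i. \<Union>(\<A> i))"
        unfolding disjoint_family_on_def
      proof (intro ballI impI)
        fix i j :: nat assume "i \<noteq> j"
        then have e: "\<A> i \<inter> \<A> j = {}" using A(2) by (auto simp: disjoint_family_on_def)
        have "\<A> i \<subseteq> \<xi>" "\<A> j \<subseteq> \<xi>" using A(1) by auto
        then show "\<Union>(\<A> i) \<inter> \<Union>(\<A> j) = {}" using e dis by blast
      qed
    qed
    also have "(\<Union>i. \<Union>(\<A> i)) = \<Union>(\<Union>i. \<A> i)" by blast
    finally show "(\<Sum>i. emeasure M (\<Union>(\<A> i))) = emeasure M (\<Union>(\<Union>i. \<A> i))" .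
  qed
  show "emeasure (quotient_measure M \<xi>) \<A> = emeasure M (\<Union>\<A>)"
    if "\<A> \<in> sets (quotient_measure M \<xi>)"
    using that ca unfolding s unfolding quotient_measure_def
    by (intro emeasure_measure_of_sigma sa) (auto simp: positive_def)
qed

end

theory Submission
  imports Defs
begin

text \<open>
  Measurability of \<open>\<rho>\<close> on \<open>X \<times> X\<close> up to null sets says nothing on the sets \<open>C \<times> C\<close>, which may all be
  null together, so the metric structure has to be used. By Fubini and separability there are points
  \<open>d k\<close>, dense in a set of full measure, whose distance functions \<open>\<rho> (d k)\<close> are integrable. On
  that set \<open>\<rho> x y\<close> is the infimum of \<open>\<rho> (d k) x + \<rho> (d k) y\<close>, so it is determined by countably many
  functions of one variable, and these remain integrable on almost every element of the partition.
  For the distance matrices, the sequence of these functions sends each conditional measure to a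
  probability measure on sequences of reals that depends measurably on \<open>C\<close>; so does its \<open>n\<close>-fold
  product, and matrix events are measurable events for that product.
\<close>

section \<open>Measurability up to null sets, separable subspaces, products of kernels\<close>

text \<open>The preimages of a measurable set under \<open>f\<close> and \<open>g\<close> differ by
  a null set, which completeness absorbs.\<close>

lemma complete_measure_measurable_AE_cong:
  assumes "complete_measure M" and f: "f \<in> M \<rightarrow>\<^sub>M N"
    and ae: "AE x in M. f x = g x" and g: "\<And>x. x \<in> space M \<Longrightarrow> g x \<in> space N"
  shows "g \<in> M \<rightarrow>\<^sub>M N"
proof (rule measurableI)
  interpret complete_measure M by fact
  fix A assume "A \<in> sets N"
  then have A: "f -` A \<inter> space M \<in> sets M"
    using f by (rule measurable_sets[rotated])
  show "g -` A \<inter> space M \<in> sets M"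
    by (rule in_sets_AE[OF _ A]) (use ae in auto)
qed (use g in auto)

lemma separable_space_mtopology_iff:
  assumes "Metric_space X d"
  shows "separable_space (Metric_space.mtopology X d) \<longleftrightarrow>
    (\<exists>S. countable S \<and> S \<subseteq> X \<and> (\<forall>x\<in>X. \<forall>r>0. \<exists>s\<in>S. d x s < r))"
proof -
  interpret Metric_space X d by fact
  show ?thesis
    unfolding separable_space_def metric_closure_of topspace_mtopology
    by (rule ex_cong1) (fastforce simp: set_eq_iff)
qed

text \<open>A countable dense subset of \<open>X\<close> may miss \<open>Y\<close> altogether, so
  each of its points is replaced by nearby points of \<open>Y\<close>, one for each scale
  \<open>1 / real (Suc n)\<close> at which there is one.\<close>

lemma separable_space_mtopology_subset:
  assumes X: "Metric_space X d" and sep: "separable_space (Metric_space.mtopology X d)"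
    and "Y \<subseteq> X"
  shows "separable_space (Metric_space.mtopology Y d)"
proof -
  interpret Metric_space X d by fact
  obtain S where S: "countable S" "S \<subseteq> X" "\<And>x r. x \<in> X \<Longrightarrow> r > 0 \<Longrightarrow> \<exists>s\<in>S. d x s < r"
    using sep separable_space_mtopology_iff[OF X] by metis
  define p where "p = (\<lambda>(s, n). SOME y. y \<in> Y \<and> d y s < 1 / real (Suc n))"
  have p: "p (s, n) \<in> Y \<and> d (p (s, n)) s < 1 / real (Suc n)"
    if "y \<in> Y" "d y s < 1 / real (Suc n)" for y s n
    unfolding p_def prod.case by (rule someI[where x = y]) (use that in auto)
  \<comment> \<open>If no point of \<open>Y\<close> is close enough to \<open>s\<close>, the choice
    \<open>p (s, n)\<close> is arbitrary, hence the intersection with \<open>Y\<close>.\<close>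
  have "\<exists>t\<in>p ` (S \<times> UNIV) \<inter> Y. d y t < r" if y: "y \<in> Y" and "r > 0" for y r
  proof -
    obtain n where n: "1 / real (Suc n) < r / 2"
      using \<open>r > 0\<close> by (metis half_gt_zero nat_approx_posE)
    obtain s where s: "s \<in> S" "d y s < 1 / real (Suc n)"
      using S(3)[of y "1 / real (Suc n)"] y \<open>Y \<subseteq> X\<close> by auto
    have t: "p (s, n) \<in> Y" "d (p (s, n)) s < 1 / real (Suc n)"
      using p[OF y s(2)] by auto
    have "d y (p (s, n)) \<le> d y s + d (p (s, n)) s"
      using triangle' y t s S(2) \<open>Y \<subseteq> X\<close> by blast
    then show ?thesis
      using s t n by (intro bexI[of _ "p (s, n)"]) auto
  qed
  then show ?thesis
    using S(1) subspace[OF \<open>Y \<subseteq> X\<close>]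
    by (subst separable_space_mtopology_iff) (auto intro!: exI[of _ "p ` (S \<times> UNIV) \<inter> Y"])
qed

text \<open>Boxes form a generator stable under intersections, and the mass of a box is a finite
  product of measurable functions of \<open>x\<close>.\<close>

lemma measurable_PiM_prob_algebra:
  assumes I: "finite I" and K: "\<And>i. i \<in> I \<Longrightarrow> K i \<in> Q \<rightarrow>\<^sub>M prob_algebra (P i)"
  shows "(\<lambda>x. \<Pi>\<^sub>M i\<in>I. K i x) \<in> Q \<rightarrow>\<^sub>M prob_algebra (\<Pi>\<^sub>M i\<in>I. P i)"
proof (rule measurable_prob_algebra_generated[OF sets_PiM Int_stable_prod_algebra prod_algebra_sets_into_space])
  have prob: "prob_space (K i x)" and sets: "sets (K i x) = sets (P i)"
    if "x \<in> space Q" "i \<in> I" for x i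
    using measurable_space[OF K, of i x] that by (auto simp: space_prob_algebra)
  fix x assume x: "x \<in> space Q"
  show "prob_space (\<Pi>\<^sub>M i\<in>I. K i x)"
    using prob x by (intro prob_space_PiM) auto
  show "sets (\<Pi>\<^sub>M i\<in>I. K i x) = sets (\<Pi>\<^sub>M i\<in>I. P i)"
    using sets x by (intro sets_PiM_cong) auto
next
  have prob: "prob_space (K i x)" and sets: "sets (K i x) = sets (P i)"
    if "x \<in> space Q" "i \<in> I" for x i
    using measurable_space[OF K, of i x] that by (auto simp: space_prob_algebra)
  fix A assume "A \<in> prod_algebra I P"
  then obtain B where B: "B \<in> (\<Pi> i\<in>I. sets (P i))" and A: "A = Pi\<^sub>E I B"
    unfolding prod_algebra_eq_finite[OF I] by auto
  have "emeasure (\<Pi>\<^sub>M i\<in>I. K i x) A = (\<Prod>i\<in>I. emeasure (K i x) (B i))" if x: "x \<in> space Q" for x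
  proof -
    \<comment> \<open>\<open>product_prob_space\<close> asks for a probability measure at every
      index, so a point mass is placed at the indices outside \<open>I\<close>.\<close>
    define K' where "K' i = (if i \<in> I then K i x else return (count_space UNIV) undefined)" for i
    have "prob_space (K' i)" for i
      using prob[OF x] by (auto simp: K'_def intro!: prob_space_return)
    then interpret product_prob_space K'
      by (rule product_prob_spaceI)
    have "emeasure (Pi\<^sub>M I K') A = (\<Prod>i\<in>I. emeasure (K' i) (B i))"
      unfolding A using I B sets[OF x] by (intro emeasure_PiM) (auto simp: K'_def)
    moreover have "Pi\<^sub>M I K' = (\<Pi>\<^sub>M i\<in>I. K i x)"
      by (rule PiM_cong) (auto simp: K'_def)
    ultimately show ?thesis
      by (simp add: K'_def)
  qed
  moreover have "(\<lambda>x. \<Prod>i\<in>I. emeasure (K i x) (B i)) \<in> borel_measurable Q"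
    using B by (intro borel_measurable_prod_ennreal
        measurable_compose[OF measurable_prob_algebraD[OF K] measurable_emeasure_subprob_algebra]) auto
  ultimately show "(\<lambda>x. emeasure (\<Pi>\<^sub>M i\<in>I. K i x) A) \<in> borel_measurable Q"
    by (simp cong: measurable_cong)
qed

section \<open>Distance profiles and skeletons of a metric\<close>

definition distance_profile :: "('a \<Rightarrow> 'a \<Rightarrow> real) \<Rightarrow> (nat \<Rightarrow> 'a) \<Rightarrow> 'a \<Rightarrow> nat \<Rightarrow> real" where
  "distance_profile \<rho> d x = (\<lambda>k. \<rho> (d k) x)"

text \<open>It depends on the two sequences only, so one and the same function recovers the metric
  for all conditional measures.\<close>

definition profile_dist :: "(nat \<Rightarrow> real) \<Rightarrow> (nat \<Rightarrow> real) \<Rightarrow> real" where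
  "profile_dist u v = (INF k. u k + v k)"

text \<open>The points \<open>d k\<close> need not lie in \<open>space L\<close>: one sequence in the whole space serves all
  elements of the partition.\<close>

definition skeleton :: "'a measure \<Rightarrow> ('a \<Rightarrow> 'a \<Rightarrow> real) \<Rightarrow> 'a set \<Rightarrow> (nat \<Rightarrow> 'a) \<Rightarrow> bool" where
  "skeleton L \<rho> X d \<longleftrightarrow> X \<in> sets L \<and> space L - X \<in> null_sets L \<and>
     separable_space (Metric_space.mtopology X \<rho>) \<and> (\<forall>k. integrable L (\<rho> (d k))) \<and>
     (\<forall>x\<in>X. \<forall>y\<in>X. \<rho> x y = profile_dist (distance_profile \<rho> d x) (distance_profile \<rho> d y))"

abbreviation profile_space :: "(nat \<Rightarrow> real) measure" where
  "profile_space \<equiv> \<Pi>\<^sub>M k\<in>UNIV. borel"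

text \<open>Arbitrary sequences may give sums without a lower bound; \<open>INF\<close> then takes a
  default value, a case that \<open>borel_measurable_cINF_real\<close> covers.\<close>

lemma measurable_profile_dist [measurable (raw)]:
  assumes f: "f \<in> L \<rightarrow>\<^sub>M profile_space" and g: "g \<in> L \<rightarrow>\<^sub>M profile_space"
  shows "(\<lambda>x. profile_dist (f x) (g x)) \<in> borel_measurable L"
  unfolding profile_dist_def
  by (intro borel_measurable_cINF_real borel_measurable_add
      measurable_compose[OF f measurable_component_singleton]
      measurable_compose[OF g measurable_component_singleton]) simp_all

lemma skeleton_measurable_profile:
  assumes "skeleton L \<rho> X d"
  shows "distance_profile \<rho> d \<in> L \<rightarrow>\<^sub>M profile_space"
proof -
  have "\<rho> (d k) \<in> borel_measurable L" for k
    using assms unfolding skeleton_def by (blast intro: borel_measurable_integrable)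
  then show ?thesis
    unfolding distance_profile_def by (intro measurable_PiM_single') simp_all
qed

text \<open>Fubini makes \<open>\<rho> x\<close> integrable for almost every \<open>x\<close>. The
  points \<open>d k\<close> are taken from the set \<open>Y\<close> of such points in the separable
  set \<open>X\<close>, and they are dense in \<open>Y\<close>.\<close>

lemma admissible_metric_obtain_skeleton:
  assumes "prob_space M" "complete_measure M" "admissible_metric M \<rho>"
  obtains X d where "skeleton M \<rho> X d"
proof -
  interpret prob_space M by fact
  interpret pair_sigma_finite M M ..
  interpret complete_measure M by fact
  interpret Metric_space "space M" \<rho>
    using assms by (simp add: admissible_metric_def)
  obtain X where X: "X \<in> sets M" "space M - X \<in> null_sets M"
      "separable_space (Metric_space.mtopology X \<rho>)"
    and meas: "(\<lambda>(x, y). \<rho> x y) \<in> borel_measurable (completion (M \<Otimes>\<^sub>M M))"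
    and fin: "(\<integral>\<^sup>+ x. \<integral>\<^sup>+ y. ennreal (\<rho> x y) \<partial>M \<partial>M) < \<infinity>"
    using assms unfolding admissible_metric_def by blast
  \<comment> \<open>Sections of a function measurable for the completed product need not be
    measurable; those of the version \<open>g\<close> are.\<close>
  obtain g where g [measurable]: "g \<in> borel_measurable (M \<Otimes>\<^sub>M M)"
    and "AE p in M \<Otimes>\<^sub>M M. (case p of (x, y) \<Rightarrow> \<rho> x y) = g p"
    using completion_ex_borel_measurable_real[OF meas] by auto
  then have ae: "AE x in M. AE y in M. \<rho> x y = g (x, y)"
    by (auto dest: AE_pair)
  have "(\<integral>\<^sup>+ x. \<integral>\<^sup>+ y. ennreal (g (x, y)) \<partial>M \<partial>M) = (\<integral>\<^sup>+ x. \<integral>\<^sup>+ y. ennreal (\<rho> x y) \<partial>M \<partial>M)"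
    by (rule nn_integral_cong_AE) (use ae in \<open>auto intro!: nn_integral_cong_AE\<close>)
  then have "AE x in M. (\<integral>\<^sup>+ y. ennreal (g (x, y)) \<partial>M) \<noteq> \<infinity>"
    using fin by (intro nn_integral_PInf_AE) auto
  then have int: "AE x in M. integrable M (\<rho> x)"
    using ae AE_space
  proof eventually_elim
    case (elim x)
    have [measurable]: "(\<lambda>y. g (x, y)) \<in> borel_measurable M"
      using elim(3) by simp
    have "AE y in M. g (x, y) = \<rho> x y"
      using elim(2) by eventually_elim simp
    then have meas: "\<rho> x \<in> borel_measurable M"
      by (rule complete_measure_measurable_AE_cong[OF assms(2), rotated]) simp_all
    have "(\<integral>\<^sup>+ y. ennreal (\<rho> x y) \<partial>M) = (\<integral>\<^sup>+ y. ennreal (g (x, y)) \<partial>M)"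
      using elim(2) by (rule nn_integral_cong_AE[OF eventually_mono]) simp
    then show ?case
      using elim(1) by (intro integrableI_nonneg meas) (simp_all add: top.not_eq_extremum)
  qed
  define Y where "Y = {x \<in> X. integrable M (\<rho> x)}"
  have null: "space M - Y \<in> null_sets M"
  proof (rule complete2)
    show "space M - Y \<subseteq> (space M - X) \<union> {x \<in> space M. \<not> integrable M (\<rho> x)}"
      by (auto simp: Y_def)
    show "(space M - X) \<union> {x \<in> space M. \<not> integrable M (\<rho> x)} \<in> null_sets M"
      using X int by (auto simp: AE_iff_null_sets)
  qed
  have YX: "Y \<subseteq> X" and XM: "X \<subseteq> space M"
    using X by (auto simp: Y_def dest: sets.sets_into_space)
  have "space M - (space M - Y) \<in> sets M"
    using null by (rule sets.compl_sets[OF null_setsD2])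
  also have "space M - (space M - Y) = Y"
    using YX XM by auto
  finally have Y: "Y \<in> sets M" .
  have ne: "Y \<noteq> {}"
    using null emeasure_space_1 by auto
  have sepY: "separable_space (Metric_space.mtopology Y \<rho>)"
    using separable_space_mtopology_subset[OF subspace[OF XM] X(3) YX] .
  obtain S where S: "countable S" "S \<subseteq> Y" "\<And>x r. x \<in> Y \<Longrightarrow> r > 0 \<Longrightarrow> \<exists>s\<in>S. \<rho> x s < r"
    using sepY separable_space_mtopology_iff[OF subspace] YX XM by (metis subset_trans)
  have Sne: "S \<noteq> {}"
    using S(3)[of _ 1] ne by fastforce
  define d where "d = from_nat_into S"
  have dS: "range d = S"
    unfolding d_def using Sne S(1) by (rule range_from_nat_into)
  have dY: "d k \<in> Y" for k
    using dS S(2) by auto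
  have "\<rho> x y = profile_dist (distance_profile \<rho> d x) (distance_profile \<rho> d y)"
    if xy: "x \<in> Y" "y \<in> Y" for x y
    unfolding profile_dist_def distance_profile_def
  proof (rule antisym)
    have M: "x \<in> space M" "y \<in> space M" "\<And>k. d k \<in> space M"
      using xy dY YX XM by blast+
    show "\<rho> x y \<le> (INF k. \<rho> (d k) x + \<rho> (d k) y)"
      using triangle M by (intro cINF_greatest) (auto simp: commute[of "d _" x])
    show "(INF k. \<rho> (d k) x + \<rho> (d k) y) \<le> \<rho> x y"
    proof (rule field_le_epsilon)
      fix e :: real assume "e > 0"
      \<comment> \<open>The detour through \<open>d k\<close> exceeds \<open>\<rho> x y\<close> by
        at most twice the distance from \<open>x\<close> to \<open>d k\<close>, hence
        \<open>e / 2\<close>.\<close>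
      then obtain k where k: "\<rho> x (d k) < e / 2"
        using S(3)[of x "e / 2"] xy dS by auto
      have "\<rho> (d k) y \<le> \<rho> (d k) x + \<rho> x y"
        using triangle M by blast
      moreover have "(INF k. \<rho> (d k) x + \<rho> (d k) y) \<le> \<rho> (d k) x + \<rho> (d k) y"
        by (intro cINF_lower bdd_belowI[of _ 0]) auto
      ultimately show "(INF k. \<rho> (d k) x + \<rho> (d k) y) \<le> \<rho> x y + e"
        using k commute[of x "d k"] by simp
    qed
  qed
  then have "skeleton M \<rho> Y d"
    using Y null sepY dY by (auto simp: skeleton_def Y_def)
  then show thesis ..
qed

text \<open>Off a null set of pairs, \<open>\<rho>\<close> is \<open>profile_dist\<close> of two
  measurable profiles. The term of index 0 in the infimum bounds it by a sum of two integrable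
  functions of one variable.\<close>

lemma skeleton_imp_admissible_metric:
  assumes "prob_space L" "Metric_space (space L) \<rho>" and sk: "skeleton L \<rho> X d"
  shows "admissible_metric L \<rho>"
proof -
  interpret prob_space L by fact
  interpret pair_sigma_finite L L ..
  interpret Metric_space "space L" \<rho> by fact
  let ?\<Phi> = "distance_profile \<rho> d"
  have [measurable]: "?\<Phi> \<in> L \<rightarrow>\<^sub>M profile_space"
    using sk by (rule skeleton_measurable_profile)
  have X: "X \<in> sets L" "space L - X \<in> null_sets L"
    and sep: "separable_space (Metric_space.mtopology X \<rho>)"
    and int: "integrable L (\<rho> (d k))"
    and eq: "\<And>x y. x \<in> X \<Longrightarrow> y \<in> X \<Longrightarrow> \<rho> x y = profile_dist (?\<Phi> x) (?\<Phi> y)" for k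
    using sk by (auto simp: skeleton_def)
  note X(1) [measurable]
  have aeX: "AE x in L. x \<in> X"
    using AE_not_in[OF X(2)] AE_space by eventually_elim auto
  have "AE p in L \<Otimes>\<^sub>M L. fst p \<in> X \<and> snd p \<in> X"
    using aeX by (intro AE_pair_measure) auto
  then have "AE p in completion (L \<Otimes>\<^sub>M L).
      profile_dist (?\<Phi> (fst p)) (?\<Phi> (snd p)) = (case p of (x, y) \<Rightarrow> \<rho> x y)"
    unfolding AE_completion_iff by eventually_elim (auto simp: eq)
  then have meas: "(\<lambda>(x, y). \<rho> x y) \<in> borel_measurable (completion (L \<Otimes>\<^sub>M L))"
    by (intro complete_measure_measurable_AE_cong[OF completion.complete_measure_axioms
          measurable_completion]) auto
  \<comment> \<open>The point \<open>d 0\<close> may lie outside \<open>space L\<close>, where no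
    triangle inequality is available; the bound comes from the infimum formula instead.\<close>
  have le: "\<rho> x y \<le> \<rho> (d 0) x + \<rho> (d 0) y" if "x \<in> X" "y \<in> X" for x y
    unfolding eq[OF that] profile_dist_def distance_profile_def
    by (intro cINF_lower bdd_belowI[of _ 0]) auto
  define c where "c = (\<integral>\<^sup>+ y. ennreal (\<rho> (d 0) y) \<partial>L)"
  have [measurable]: "\<rho> (d 0) \<in> borel_measurable L"
    using int by auto
  have c: "c < \<infinity>"
    unfolding c_def using int[of 0] by (simp add: integrable_iff_bounded)
  have "(\<integral>\<^sup>+ x. \<integral>\<^sup>+ y. ennreal (\<rho> x y) \<partial>L \<partial>L)
      \<le> (\<integral>\<^sup>+ x. \<integral>\<^sup>+ y. ennreal (\<rho> (d 0) x) + ennreal (\<rho> (d 0) y) \<partial>L \<partial>L)"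
    using aeX
    by (intro nn_integral_mono_AE; eventually_elim; intro nn_integral_mono_AE; use aeX in eventually_elim)
       (simp add: le flip: ennreal_plus)
  also have "\<dots> = c + c"
    by (simp add: nn_integral_add emeasure_space_1 c_def)
  also have "\<dots> < \<infinity>"
    using c by simp
  finally show ?thesis
    unfolding admissible_metric_def using X sep meas by (intro conjI assms(2)) auto
qed

section \<open>Laws of distance matrices\<close>

definition profile_matrix :: "('n::finite \<Rightarrow> nat \<Rightarrow> real) \<Rightarrow> real^'n^'n" where
  "profile_matrix u = (\<chi> i j. profile_dist (u i) (u j))"

lemma measurable_profile_matrix [measurable]:
  "profile_matrix \<in> borel_measurable (\<Pi>\<^sub>M i\<in>UNIV. profile_space)"
  unfolding borel_measurable_euclidean_space[of profile_matrix]
proof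
  fix b :: "real^'n^'n" assume "b \<in> Basis"
  then obtain i j where b: "b = axis i (axis j 1)"
    by (auto simp: Basis_vec_def)
  show "(\<lambda>u. profile_matrix u \<bullet> b) \<in> borel_measurable (\<Pi>\<^sub>M i\<in>UNIV. profile_space)"
    by (simp add: b inner_axis profile_matrix_def)
qed

text \<open>Almost surely all sampled points lie in \<open>X\<close>, where the distance matrix is a
  function of the profiles. The event thus becomes a fixed set of families of profiles, and
  \<open>L\<close> enters only through the law of one profile.\<close>

lemma
  fixes \<Omega> :: "(real^'n^'n) set"
  assumes "prob_space L" and sk: "skeleton L \<rho> X d" and \<Omega>: "open \<Omega>"
  shows skeleton_distance_matrix_event:
      "distance_matrix_event L \<rho> \<Omega> \<in> sets (completion (Pi\<^sub>M UNIV (\<lambda>_. L)))" (is ?event)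
    and skeleton_distance_matrix_prob:
      "distance_matrix_prob L \<rho> \<Omega> =
        measure (\<Pi>\<^sub>M i\<in>UNIV. distr L profile_space (distance_profile \<rho> d)) (profile_matrix -` \<Omega>)" (is ?prob)
proof -
  interpret prob_space L by fact
  let ?\<Phi> = "distance_profile \<rho> d" and ?L = "\<Pi>\<^sub>M i\<in>(UNIV :: 'n set). L"
    and ?P = "\<Pi>\<^sub>M i\<in>(UNIV :: 'n set). profile_space"
  interpret P: prob_space ?L
    by (intro prob_space_PiM) unfold_locales
  interpret C: prob_space "completion ?L"
    by (rule P.prob_space_completion)
  have \<Phi> [measurable]: "?\<Phi> \<in> L \<rightarrow>\<^sub>M profile_space"
    using sk by (rule skeleton_measurable_profile)
  have h [measurable]: "compose UNIV ?\<Phi> \<in> ?L \<rightarrow>\<^sub>M ?P"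
    unfolding compose_def by measurable
  have [simp]: "space ?P = UNIV"
    by (simp add: space_PiM)
  have D: "profile_matrix -` \<Omega> \<in> sets ?P"
    using measurable_sets[OF measurable_profile_matrix borel_open[OF \<Omega>]] by simp
  \<comment> \<open>The event rewritten in terms of profiles: it is measurable before completion and
    agrees with the original one almost everywhere.\<close>
  define E where "E = compose UNIV ?\<Phi> -` (profile_matrix -` \<Omega>) \<inter> space ?L"
  have E: "E \<in> sets ?L"
    unfolding E_def using h D by (rule measurable_sets)
  have X: "space L - X \<in> null_sets L"
    and eq: "\<And>x y. x \<in> X \<Longrightarrow> y \<in> X \<Longrightarrow> \<rho> x y = profile_dist (?\<Phi> x) (?\<Phi> y)"
    using sk by (auto simp: skeleton_def)
  have aeX: "AE x in L. x \<in> X"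
    using AE_not_in[OF X] AE_space by eventually_elim auto
  have "AE z in ?L. \<forall>i. z i \<in> X"
    using aeX by (subst AE_all_countable) (auto intro!: AE_PiM_component prob_space_axioms)
  then have ae: "AE z in completion ?L. z \<in> E \<longleftrightarrow> z \<in> distance_matrix_event L \<rho> \<Omega>"
    unfolding AE_completion_iff using AE_space
  proof eventually_elim
    case (elim z)
    then have "(\<chi> i j. \<rho> (z i) (z j)) = profile_matrix (compose UNIV ?\<Phi> z)"
      by (simp add: profile_matrix_def compose_def eq)
    with elim show ?case
      by (simp add: E_def distance_matrix_event_def)
  qed
  show *: ?event
    by (rule completion.in_sets_AE[OF ae]) (use E in \<open>auto simp: distance_matrix_event_def\<close>)
  have "distance_matrix_prob L \<rho> \<Omega> = measure (completion ?L) E"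
    unfolding distance_matrix_prob_def
    by (rule C.finite_measure_eq_AE) (use ae E * in auto)
  also have "\<dots> = measure (distr ?L ?P (compose UNIV ?\<Phi>)) (profile_matrix -` \<Omega>)"
    using E by (simp add: measure_distr[OF h D] E_def)
  also have "distr ?L ?P (compose UNIV ?\<Phi>) = (\<Pi>\<^sub>M i\<in>UNIV. distr L profile_space ?\<Phi>)"
  proof -
    \<comment> \<open>The product rule is applied with probability measures as targets, so
      \<open>?D\<close> stands in for \<open>profile_space\<close>; \<open>distr\<close> depends
      only on the measurable sets of its target.\<close>
    let ?D = "distr L profile_space ?\<Phi>"
    have "distr ?L (\<Pi>\<^sub>M i\<in>UNIV. ?D) (compose UNIV ?\<Phi>) = (\<Pi>\<^sub>M i\<in>UNIV. distr L ?D ?\<Phi>)"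
      by (intro distr_PiM_finite_prob_space' prob_space_distr prob_space_axioms) simp_all
    moreover have "distr ?L (\<Pi>\<^sub>M i\<in>UNIV. ?D) (compose UNIV ?\<Phi>) = distr ?L ?P (compose UNIV ?\<Phi>)"
      by (intro distr_cong sets_PiM_cong) simp_all
    moreover have "distr L ?D ?\<Phi> = ?D"
      by (intro distr_cong) simp_all
    ultimately show ?thesis
      by simp
  qed
  finally show ?prob .
qed

section \<open>Disintegration over the base\<close>

lemma complete_measure_quotient_measure:
  assumes "complete_measure M" and \<xi>: "partition_on (space M) \<xi>"
  shows "complete_measure (quotient_measure M \<xi>)"
proof
  interpret complete_measure M by fact
  fix \<A> \<B> assume "\<B> \<subseteq> \<A>" and \<A>: "\<A> \<in> null_sets (quotient_measure M \<xi>)"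
  then have "\<Union>\<A> \<in> null_sets M" "\<A> \<subseteq> \<xi>"
    using emeasure_quotient_measure[OF \<xi>, of \<A>] sets_quotient_measure[OF \<xi>] by (auto simp: null_sets_def)
  moreover from this have "\<Union>\<B> \<in> sets M"
    using \<open>\<B> \<subseteq> \<A>\<close> by (intro complete[OF Union_mono])
  ultimately show "\<B> \<in> sets (quotient_measure M \<xi>)"
    using \<open>\<B> \<subseteq> \<A>\<close> by (simp add: sets_quotient_measure[OF \<xi>])
qed

text \<open>The masses of \<open>A\<close> in the elements of \<open>\<xi>\<close> are nonnegative
  and integrate to the mass of \<open>A\<close>, which is 0.\<close>

lemma canonical_system_null_sets:
  assumes can: "canonical_system M \<xi> \<mu>" and A: "A \<in> null_sets M"
  shows "AE C in quotient_measure M \<xi>. A \<inter> C \<in> null_sets (\<mu> C)"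
proof -
  let ?Q = "quotient_measure M \<xi>" and ?f = "indicator A :: 'a \<Rightarrow> real"
  have "integrable M ?f"
    using A by (auto simp: integrable_indicator_iff null_sets_def)
  then have 1: "AE C in ?Q. integrable (\<mu> C) ?f"
    and 2: "integrable ?Q (\<lambda>C. \<integral>x. ?f x \<partial>\<mu> C)"
    and 3: "(\<integral>x. ?f x \<partial>M) = (\<integral>C. (\<integral>x. ?f x \<partial>\<mu> C) \<partial>?Q)"
    using can by (auto simp: canonical_system_def)
  have "(\<integral>x. ?f x \<partial>M) = 0"
    using A by (simp add: measure_def null_sets_def)
  then have "AE C in ?Q. (\<integral>x. ?f x \<partial>\<mu> C) = 0"
    using integral_nonneg_eq_0_iff_AE[OF 2] 3 by auto
  moreover have "AE C in ?Q. space (\<mu> C) = C"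
    using can by (auto simp: canonical_system_def)
  ultimately show ?thesis
    using 1
  proof eventually_elim
    case (elim C)
    \<comment> \<open>Integrability of the indicator rules out that the integral vanishes only by
      default, for a non-measurable trace of \<open>A\<close> or one of infinite mass.\<close>
    then have "A \<inter> C \<in> sets (\<mu> C)" "emeasure (\<mu> C) (A \<inter> C) \<noteq> \<infinity>"
      by (auto simp: integrable_indicator_iff)
    with elim show ?case
      by (simp add: null_sets_def emeasure_eq_ennreal_measure)
  qed
qed

text \<open>A skeleton involves countably many integrable functions and one null set, so the
  exceptional elements form a null set. Separability and the pointwise infimum formula pass to
  subsets.\<close>

lemma canonical_system_skeleton:
  assumes can: "canonical_system M \<xi> \<mu>" and \<xi>: "partition_on (space M) \<xi>"
    and "finite_measure M" and met: "Metric_space (space M) \<rho>" and sk: "skeleton M \<rho> X d"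
  shows "AE C in quotient_measure M \<xi>. skeleton (\<mu> C) \<rho> (X \<inter> C) d"
proof -
  let ?Q = "quotient_measure M \<xi>"
  interpret finite_measure M by fact
  have X: "X \<in> sets M" "space M - X \<in> null_sets M"
    and sep: "separable_space (Metric_space.mtopology X \<rho>)"
    and int: "\<And>k. integrable M (\<rho> (d k))"
    using sk by (auto simp: skeleton_def)
  have metX: "Metric_space X \<rho>"
    using Metric_space.subspace[OF met] X(1) by (auto dest: sets.sets_into_space)
  \<comment> \<open>Disintegrating this indicator makes \<open>X \<inter> C\<close> measurable for
    \<open>\<mu> C\<close>.\<close>
  have "integrable M (indicator X :: 'a \<Rightarrow> real)"
    using X by (auto simp: integrable_indicator_iff top.not_eq_extremum[symmetric])
  then have "AE C in ?Q. integrable (\<mu> C) (indicator X :: 'a \<Rightarrow> real)"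
    using can by (auto simp: canonical_system_def)
  moreover have "AE C in ?Q. space (\<mu> C) = C"
    using can by (auto simp: canonical_system_def)
  moreover have "AE C in ?Q. \<forall>k. integrable (\<mu> C) (\<rho> (d k))"
    using can int by (subst AE_all_countable) (auto simp: canonical_system_def)
  moreover note canonical_system_null_sets[OF can X(2)] AE_space[of ?Q]
  ultimately show ?thesis
  proof eventually_elim
    case (elim C)
    have "C \<subseteq> space M"
      using elim \<xi> by (auto simp: space_quotient_measure partition_on_def)
    then have "C - X \<inter> C = (space M - X) \<inter> C"
      by auto
    then show ?case
      using elim sk separable_space_mtopology_subset[OF metX sep, of "X \<inter> C"]
      by (auto simp: skeleton_def integrable_indicator_iff)
  qed
qed

text \<open>For almost every \<open>C\<close>, the mass that \<open>K C\<close> gives to a set is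
  the integral over \<open>C\<close> of the indicator of its preimage under \<open>f\<close>, which
  is measurable in \<open>C\<close> by disintegration. \<open>K\<close> is a separate function
  because \<open>prob_algebra\<close> constrains every \<open>C\<close>, while the law of
  \<open>f\<close> under \<open>\<mu> C\<close> is controlled only almost everywhere.\<close>

lemma canonical_system_measurable_kernel:
  assumes can: "canonical_system M \<xi> \<mu>" and "complete_measure (quotient_measure M \<xi>)"
    and "finite_measure M" and f: "f \<in> M \<rightarrow>\<^sub>M P"
    and K: "K \<in> space (quotient_measure M \<xi>) \<rightarrow> space (prob_algebra P)"
    and ae: "AE C in quotient_measure M \<xi>.
      C \<subseteq> space M \<and> f \<in> \<mu> C \<rightarrow>\<^sub>M P \<and> K C = distr (\<mu> C) P f"
  shows "K \<in> quotient_measure M \<xi> \<rightarrow>\<^sub>M prob_algebra P"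
proof (rule measurable_prob_algebra_generated[OF sets.sigma_sets_eq[symmetric] sets.Int_stable sets.space_closed])
  let ?Q = "quotient_measure M \<xi>"
  interpret finite_measure M by fact
  show prob: "prob_space (K C)" "sets (K C) = sets P" if "C \<in> space ?Q" for C
    using K that by (auto simp: space_prob_algebra)
  fix A assume A: "A \<in> sets P"
  let ?B = "f -` A \<inter> space M"
  have "?B \<in> sets M"
    using f A by (rule measurable_sets)
  then have "integrable M (indicator ?B :: 'a \<Rightarrow> real)"
    by (auto simp: integrable_indicator_iff top.not_eq_extremum[symmetric])
  then have meas: "(\<lambda>C. ennreal (\<integral>x. indicator ?B x \<partial>\<mu> C)) \<in> borel_measurable ?Q"
    using can by (auto simp: canonical_system_def)
  have sp: "AE C in ?Q. space (\<mu> C) = C"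
    using can by (auto simp: canonical_system_def)
  show "(\<lambda>C. emeasure (K C) A) \<in> borel_measurable ?Q"
  proof (rule complete_measure_measurable_AE_cong[OF assms(2) meas])
    show "AE C in ?Q. ennreal (\<integral>x. indicator ?B x \<partial>\<mu> C) = emeasure (K C) A"
      using ae sp AE_space
    proof eventually_elim
      case (elim C)
      interpret K: prob_space "K C"
        using elim by (intro prob) auto
      have "?B \<inter> space (\<mu> C) = f -` A \<inter> space (\<mu> C)"
        using elim by auto
      then have "(\<integral>x. indicator ?B x \<partial>\<mu> C) = measure (K C) A"
        using elim A by (simp add: measure_distr)
      then show ?case
        by (simp add: K.emeasure_eq_measure)
    qed
  qed simp
qed

section \<open>Admissibility of the restrictions and measurability of the matrix
  probabilities\<close>

theorem theorem3:
  fixes M :: "'a measure" and \<rho> :: "'a \<Rightarrow> 'a \<Rightarrow> real"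
    and N :: "'b measure" and \<pi> :: "'a \<Rightarrow> 'b" and \<xi> :: "'a set set"
    and \<mu> :: "'a set \<Rightarrow> 'a measure"
  assumes "admissible_triple M \<rho>"
    and "measurable_partition M N \<pi> \<xi>"
    and "canonical_system M \<xi> \<mu>"
  shows "(AE C in quotient_measure M \<xi>. space (\<mu> C) = C \<and> admissible_triple (\<mu> C) \<rho>) \<and>
         (\<forall>\<Omega> :: (real^'n^'n) set. open \<Omega> \<longrightarrow>
            (AE C in quotient_measure M \<xi>.
               distance_matrix_event (\<mu> C) \<rho> \<Omega> \<in> sets (completion (Pi\<^sub>M UNIV (\<lambda>_. \<mu> C)))) \<and>
            (\<lambda>C. distance_matrix_prob (\<mu> C) \<rho> \<Omega>) \<in> borel_measurable (quotient_measure M \<xi>))"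
proof -
  let ?Q = "quotient_measure M \<xi>"
  note can = assms(3)
  have M: "prob_space M" "complete_measure M" "admissible_metric M \<rho>"
    using assms(1) by (auto simp: admissible_triple_def lebesgue_space_def)
  interpret prob_space M by fact
  have met: "Metric_space (space M) \<rho>"
    using M by (simp add: admissible_metric_def)
  have \<xi>: "partition_on (space M) \<xi>"
    using assms(2) by (rule partition_on_measurable_partition)
  have compl: "complete_measure ?Q"
    using M(2) \<xi> by (rule complete_measure_quotient_measure)
  obtain X d where sk: "skeleton M \<rho> X d"
    using admissible_metric_obtain_skeleton[OF M] .
  let ?\<Phi> = "distance_profile \<rho> d"
  define good where "good C \<longleftrightarrow> lebesgue_space (\<mu> C) \<and> space (\<mu> C) = C \<and> C \<subseteq> space M \<and>
    skeleton (\<mu> C) \<rho> (X \<inter> C) d" for C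
  have "AE C in ?Q. lebesgue_space (\<mu> C) \<and> space (\<mu> C) = C"
    using can by (simp add: canonical_system_def)
  moreover note canonical_system_skeleton[OF can \<xi> finite_measure_axioms met sk] AE_space[of ?Q]
  ultimately have good: "AE C in ?Q. good C"
    by eventually_elim (use \<xi> in \<open>auto simp: good_def space_quotient_measure partition_on_def\<close>)
  have goodD: "prob_space (\<mu> C)" "skeleton (\<mu> C) \<rho> (X \<inter> C) d"
    "?\<Phi> \<in> \<mu> C \<rightarrow>\<^sub>M profile_space" if "good C" for C
    using that skeleton_measurable_profile by (auto simp: good_def lebesgue_space_def)
  have admissible: "AE C in ?Q. space (\<mu> C) = C \<and> admissible_triple (\<mu> C) \<rho>"
    using good
  proof eventually_elim
    case (elim C)
    then have "Metric_space (space (\<mu> C)) \<rho>"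
      using Metric_space.subspace[OF met, of C] by (simp add: good_def)
    then show ?case
      using skeleton_imp_admissible_metric[OF goodD(1)[OF elim] _ goodD(2)[OF elim]] elim
      by (simp add: good_def admissible_triple_def)
  qed
  \<comment> \<open>On exceptional \<open>C\<close> the law of the profile under \<open>M\<close> is
    substituted, so that \<open>K C\<close> is a probability measure for every
    \<open>C\<close>.\<close>
  define K where "K C = distr (if good C then \<mu> C else M) profile_space ?\<Phi>" for C
  have K: "K \<in> ?Q \<rightarrow>\<^sub>M prob_algebra profile_space"
  proof (rule canonical_system_measurable_kernel[OF can compl finite_measure_axioms])
    show \<Phi>: "?\<Phi> \<in> M \<rightarrow>\<^sub>M profile_space"
      using sk by (rule skeleton_measurable_profile)
    show "K \<in> space ?Q \<rightarrow> space (prob_algebra profile_space)"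
      using goodD \<Phi> by (auto simp: K_def space_prob_algebra prob_space_axioms
          intro!: prob_space.prob_space_distr)
    show "AE C in ?Q. C \<subseteq> space M \<and> ?\<Phi> \<in> \<mu> C \<rightarrow>\<^sub>M profile_space \<and> K C = distr (\<mu> C) profile_space ?\<Phi>"
      using good by eventually_elim (use goodD(3) in \<open>auto simp: K_def good_def\<close>)
  qed
  show ?thesis
  proof (intro conjI allI impI admissible)
    fix \<Omega> :: "(real^'n^'n) set" assume \<Omega>: "open \<Omega>"
    show "AE C in ?Q. distance_matrix_event (\<mu> C) \<rho> \<Omega> \<in> sets (completion (Pi\<^sub>M UNIV (\<lambda>_. \<mu> C)))"
      using good by eventually_elim (use goodD skeleton_distance_matrix_event \<Omega> in blast)
    let ?P = "\<Pi>\<^sub>M i\<in>(UNIV :: 'n set). profile_space"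
    have "profile_matrix -` \<Omega> \<in> sets ?P"
      using measurable_sets[OF measurable_profile_matrix borel_open[OF \<Omega>]] by (simp add: space_PiM)
    moreover have "(\<lambda>C. \<Pi>\<^sub>M i\<in>(UNIV :: 'n set). K C) \<in> ?Q \<rightarrow>\<^sub>M subprob_algebra ?P"
      by (intro measurable_prob_algebraD measurable_PiM_prob_algebra K) simp
    \<comment> \<open>The set of profiles does not vary with \<open>C\<close>, so this evaluates a
      measurable family of measures at a fixed measurable set.\<close>
    ultimately have "(\<lambda>C. measure (\<Pi>\<^sub>M i\<in>(UNIV :: 'n set). K C) (profile_matrix -` \<Omega>)) \<in> borel_measurable ?Q"
      by (rule measurable_compose[OF _ measurable_measure_subprob_algebra, rotated])
    then show "(\<lambda>C. distance_matrix_prob (\<mu> C) \<rho> \<Omega>) \<in> borel_measurable ?Q"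
    proof (rule complete_measure_measurable_AE_cong[OF compl])
      show "AE C in ?Q. measure (\<Pi>\<^sub>M i\<in>(UNIV :: 'n set). K C) (profile_matrix -` \<Omega>)
          = distance_matrix_prob (\<mu> C) \<rho> \<Omega>"
        using good
        by eventually_elim (simp add: K_def skeleton_distance_matrix_prob[OF goodD(1,2) \<Omega>])
    qed simp
  qed
qed

end
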